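(* Let $d>0$ be an integer and consider the following propositions (for fixed $n$ and $S=k[x_1,\ldots,x_n]$). (A) Every $d$-clutter $\mathcal{C}$ on $[n]$ with $I(\overline{\mathcal{C}})$ having linear quotients is chordal. (B) Every non-empty $d$-clutter $\mathcal{C}$ on $[n]$ with $I(\overline{\mathcal{C}})$ having linear quotients has a simplicial maximal subcircuit. (C) Every order of linear quotients for a non-complete squarefree monomial ideal $I$ of $S$ generated in degree $d$ can be extended to an order of linear quotients for the complete squarefree monomial ideal of $S$ generated in degree $d$ (that is, if $u_1,\ldots,u_t$ is an order of linear quotients for $I$, then there are monomials $u_{t+1},\ldots,u_N$ such that $u_1,\ldots,u_N$ is an order of linear quotients for the complete ideal). Then (A) and (B) are equivalent, and (B) implies (C).
   Context: Let $[n]=\{1,\ldots,n\}$. A $d$-clutter on $[n]$ is a (possibly empty) family $\mathcal{C}$ of $(d+1)$-subsets of $[n]$, called circuits. $\overline{\mathcal{C}}$ is the family of all $(d+1)$-subsets of $[n]$ not in $\mathcal{C}$. $k$ is a field, $S=k[x_1,\ldots,x_n]$, $x_F=\prod_{i\in F}x_i$ for $F\subseteq[n]$, and $I(\mathcal{C})=\langle x_F: F\in\mathcal{C}\rangle\subseteq S$ (so $I(\emptyset)=0$). Chordality: a maximal subcircuit (MS) of $\mathcal{C}$ is a $d$-subset of $[n]$ contained in some circuit. For $e\subseteq[n]$, $\mathcal{C}-e$ is the family of circuits that do not contain $e$. A set $L\subseteq[n]$ is a clique in $\mathcal{C}$ if every $(d+1)$-subset of $L$ is in $\mathcal{C}$.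 For an MS $e$, $\mathrm{N}[e]=e\cup\{v\in[n]: e\cup\{v\}\in\mathcal{C}\}$; $e$ is simplicial if $\mathrm{N}[e]$ is a clique. $\mathcal{C}$ is chordal if it is empty or there is a sequence $e_1,\ldots,e_t$ such that $e_i$ is a simplicial maximal subcircuit of $\mathcal{C}-e_1-\cdots-e_{i-1}$ for each $i$ and $\mathcal{C}-e_1-\cdots-e_t=\emptyset$. Linear quotients: an order of linear quotients for a monomial ideal $I$ is an ordering $u_1,\ldots,u_m$ of its minimal monomial generators such that for each $2\le i\le m$ the colon ideal $\langle u_1,\ldots,u_{i-1}\rangle : u_i$ is generated by a subset of the variables; $I$ has linear quotients if such an order exists (the zero ideal has linear quotients via the empty order). A squarefree monomial ideal of $S$ generated in degree $d$ is complete if it contains all squarefree monomials of degree $d$ of $S$, and non-complete otherwise. *)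

theory Defs
  imports "HOL-Library.Poly_Mapping" "HOL-Algebra.Ideal" "HOL-Algebra.Divisibility"
begin

section \<open>The polynomial ring in n variables and its monomial ideals\<close>

text \<open>
  Polynomials are finitely supported functions from exponent vectors to coefficients; the library's
  multiplication on them is convolution. The type provides a variable for every natural number, and
  the carrier of \<open>poly_ring n\<close> consists of the polynomials involving only
  the variables with index in \<open>{1..n}\<close>.
\<close>

type_synonym 'k mpoly = "(nat \<Rightarrow>\<^sub>0 nat) \<Rightarrow>\<^sub>0 'k"

definition poly_ring :: "nat \<Rightarrow> 'k::field mpoly ring" where
  "poly_ring n = \<lparr>carrier = {p. \<forall>a\<in>Poly_Mapping.keys p. Poly_Mapping.keys a \<subseteq> {1..n}},
                  monoid.mult = (*), one = 1, zero = 0, add = (+)\<rparr>"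

definition var :: "nat \<Rightarrow> 'k::field mpoly" where
  "var i = Poly_Mapping.single (Poly_Mapping.single i 1) 1"

definition var_prod :: "nat set \<Rightarrow> 'k::field mpoly" where
  "var_prod F = (\<Prod>i\<in>F. var i)"

definition monomials :: "nat \<Rightarrow> 'k::field mpoly set" where
  "monomials n = {Poly_Mapping.single a 1 | a. Poly_Mapping.keys a \<subseteq> {1..n}}"

definition sqfree_monomials :: "nat \<Rightarrow> nat \<Rightarrow> 'k::field mpoly set" where
  "sqfree_monomials n d = {var_prod F | F. F \<subseteq> {1..n} \<and> card F = d}"

text \<open>The empty set of generators is allowed, so the zero ideal is generated in every degree.\<close>

definition sqfree_ideal_gen_in_degree :: "nat \<Rightarrow> nat \<Rightarrow> 'k::field mpoly set \<Rightarrow> bool" where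
  "sqfree_ideal_gen_in_degree n d I \<longleftrightarrow>
     (\<exists>G \<subseteq> sqfree_monomials n d. I = Idl\<^bsub>poly_ring n\<^esub> G)"

definition complete_in_degree :: "nat \<Rightarrow> nat \<Rightarrow> 'k::field mpoly set \<Rightarrow> bool" where
  "complete_in_degree n d I \<longleftrightarrow> sqfree_monomials n d \<subseteq> I"

definition complete_ideal :: "nat \<Rightarrow> nat \<Rightarrow> 'k::field mpoly set" where
  "complete_ideal n d = Idl\<^bsub>poly_ring n\<^esub> (sqfree_monomials n d)"

text \<open>For a monomial ideal, its minimal monomial generators are the monomials in it that are
  minimal with respect to divisibility.\<close>

definition min_mono_gens :: "nat \<Rightarrow> 'k::field mpoly set \<Rightarrow> 'k mpoly set" where
  "min_mono_gens n I =
     {u \<in> monomials n \<inter> I. \<forall>v \<in> monomials n \<inter> I. v divides\<^bsub>poly_ring n\<^esub> u \<longrightarrow> v = u}"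

definition colon_ideal :: "('a, 'b) ring_scheme \<Rightarrow> 'a set \<Rightarrow> 'a \<Rightarrow> 'a set" where
  "colon_ideal R I u = {f \<in> carrier R. f \<otimes>\<^bsub>R\<^esub> u \<in> I}"

text \<open>Lists are indexed from 0, so the colon condition ranges over all entries but the first.\<close>

definition linear_quotients_order :: "nat \<Rightarrow> 'k::field mpoly set \<Rightarrow> 'k mpoly list \<Rightarrow> bool" where
  "linear_quotients_order n I us \<longleftrightarrow>
     distinct us \<and> set us = min_mono_gens n I \<and>
     (\<forall>i. 1 \<le> i \<and> i < length us \<longrightarrow>
        (\<exists>V \<subseteq> {1..n}. colon_ideal (poly_ring n) (Idl\<^bsub>poly_ring n\<^esub> (set (take i us))) (us ! i)
                      = Idl\<^bsub>poly_ring n\<^esub> (var ` V)))"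

definition has_linear_quotients :: "nat \<Rightarrow> 'k::field mpoly set \<Rightarrow> bool" where
  "has_linear_quotients n I \<longleftrightarrow> (\<exists>us. linear_quotients_order n I us)"


section \<open>Clutters and chordality\<close>

definition clutter :: "nat \<Rightarrow> nat \<Rightarrow> nat set set \<Rightarrow> bool" where
  "clutter n d C \<longleftrightarrow> (\<forall>F\<in>C. F \<subseteq> {1..n} \<and> card F = d + 1)"

definition compl_clutter :: "nat \<Rightarrow> nat \<Rightarrow> nat set set \<Rightarrow> nat set set" where
  "compl_clutter n d C = {F. F \<subseteq> {1..n} \<and> card F = d + 1 \<and> F \<notin> C}"

definition circuit_ideal :: "nat \<Rightarrow> nat set set \<Rightarrow> 'k::field mpoly set" where
  "circuit_ideal n C = Idl\<^bsub>poly_ring n\<^esub> (var_prod ` C)"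

definition maximal_subcircuit :: "nat \<Rightarrow> nat \<Rightarrow> nat set set \<Rightarrow> nat set \<Rightarrow> bool" where
  "maximal_subcircuit n d C e \<longleftrightarrow> e \<subseteq> {1..n} \<and> card e = d \<and> (\<exists>F\<in>C. e \<subseteq> F)"

definition delete :: "nat set set \<Rightarrow> nat set \<Rightarrow> nat set set" where
  "delete C e = {F\<in>C. \<not> e \<subseteq> F}"

definition clique :: "nat \<Rightarrow> nat \<Rightarrow> nat set set \<Rightarrow> nat set \<Rightarrow> bool" where
  "clique n d C L \<longleftrightarrow> L \<subseteq> {1..n} \<and> (\<forall>F. F \<subseteq> L \<and> card F = d + 1 \<longrightarrow> F \<in> C)"

definition closed_nbhd :: "nat \<Rightarrow> nat set set \<Rightarrow> nat set \<Rightarrow> nat set" where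
  "closed_nbhd n C e = e \<union> {v\<in>{1..n}. e \<union> {v} \<in> C}"

definition simplicial_ms :: "nat \<Rightarrow> nat \<Rightarrow> nat set set \<Rightarrow> nat set \<Rightarrow> bool" where
  "simplicial_ms n d C e \<longleftrightarrow> maximal_subcircuit n d C e \<and> clique n d C (closed_nbhd n C e)"

definition chordal :: "nat \<Rightarrow> nat \<Rightarrow> nat set set \<Rightarrow> bool" where
  "chordal n d C \<longleftrightarrow>
     C = {} \<or>
     (\<exists>es. (\<forall>i < length es. simplicial_ms n d (foldl delete C (take i es)) (es ! i)) \<and>
           foldl delete C es = {})"


section \<open>The three propositions, for a given field of coefficients\<close>

definition lq_imp_chordal :: "'k::field itself \<Rightarrow> nat \<Rightarrow> nat \<Rightarrow> bool" where
  "lq_imp_chordal _ n d \<longleftrightarrow>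
     (\<forall>C. clutter n d C \<and>
          has_linear_quotients n (circuit_ideal n (compl_clutter n d C) :: 'k mpoly set)
          \<longrightarrow> chordal n d C)"

definition lq_imp_simplicial_ms :: "'k::field itself \<Rightarrow> nat \<Rightarrow> nat \<Rightarrow> bool" where
  "lq_imp_simplicial_ms _ n d \<longleftrightarrow>
     (\<forall>C. clutter n d C \<and> C \<noteq> {} \<and>
          has_linear_quotients n (circuit_ideal n (compl_clutter n d C) :: 'k mpoly set)
          \<longrightarrow> (\<exists>e. simplicial_ms n d C e))"

definition lq_orders_extend :: "'k::field itself \<Rightarrow> nat \<Rightarrow> nat \<Rightarrow> bool" where
  "lq_orders_extend _ n d \<longleftrightarrow>
     (\<forall>(I :: 'k mpoly set) us.
        sqfree_ideal_gen_in_degree n d I \<and> \<not> complete_in_degree n d I \<and> linear_quotients_order n I us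
        \<longrightarrow> (\<exists>vs. linear_quotients_order n (complete_ideal n d) (us @ vs)))"

end

theory Submission
  imports Defs
begin

text \<open>
  Having linear quotients is a combinatorial property of the supports: \<open>x\<^sub>F\<close> may follow the generators
  \<open>x\<^sub>G\<close>, \<open>G \<in> D\<close>, iff for all \<open>G \<in> D\<close> there are \<open>H \<in> D\<close> and \<open>v \<in> G\<close> with \<open>H - F = {v}\<close>.

  (B) implies (A): if \<open>e\<close> is simplicial in \<open>C\<close>, the circuits containing \<open>e\<close> can be appended in any
  order to an order of linear quotients for the complement of \<open>C\<close>, because a non-circuit \<open>G\<close> has a
  vertex \<open>v\<close> outside the clique \<open>N[e]\<close>, and \<open>e \<union> {v}\<close> is then a non-circuit as well. Hence deleting
  \<open>e\<close> preserves linear quotients.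

  (B) implies (C): let \<open>D\<close> be the \<open>d\<close>-sets of the generators. The sets of size \<open>d + 1\<close> containing
  a member of \<open>D\<close> again have linear quotients, so (B) gives a simplicial maximal subcircuit \<open>e\<close> of
  the clutter of all other \<open>(d + 1)\<close>-sets, and \<open>x\<^sub>e\<close> can be appended to the given order. If that clutter is
  empty, any \<open>d\<close>-set outside \<open>D\<close> can be appended.
\<close>

section \<open>Orders of linear quotients for set families\<close>

text \<open>\<open>uniform n (d + 1)\<close> agrees with \<open>clutter n d\<close>; the unshifted
  index suits ideals generated in degree \<open>d\<close> as well as circuit ideals.\<close>

definition uniform :: "nat \<Rightarrow> nat \<Rightarrow> nat set set \<Rightarrow> bool" where
  "uniform n d D \<longleftrightarrow> (\<forall>F\<in>D. F \<subseteq> {1..n} \<and> card F = d)"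

text \<open>The colon ideal of the \<open>x_G\<close>, \<open>G \<in> D\<close>, by
  \<open>x_F\<close> is generated by the \<open>x_(G - F)\<close>. As \<open>H - F = {v}\<close>
  forces \<open>v \<notin> F\<close>, the condition says that each \<open>G - F\<close> contains
  some \<open>v\<close> whose variable is itself one of these generators.\<close>

definition lq_step :: "'a set set \<Rightarrow> 'a set \<Rightarrow> bool" where
  "lq_step D F \<longleftrightarrow> (\<forall>G\<in>D. \<exists>H\<in>D. \<exists>v\<in>G. H - F = {v})"

definition lq_order :: "'a set list \<Rightarrow> bool" where
  "lq_order Fs \<longleftrightarrow> (\<forall>i<length Fs. lq_step (set (take i Fs)) (Fs ! i))"

definition has_lq_order :: "'a set set \<Rightarrow> bool" where
  "has_lq_order D \<longleftrightarrow> (\<exists>Fs. distinct Fs \<and> set Fs = D \<and> lq_order Fs)"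

lemma lq_order_Nil [simp]: "lq_order []"
  by (simp add: lq_order_def)

lemma lq_order_snoc [simp]: "lq_order (Fs @ [F]) \<longleftrightarrow> lq_order Fs \<and> lq_step (set Fs) F"
  by (auto simp: lq_order_def nth_append less_Suc_eq all_conj_distrib)

lemma uniform_finite: "uniform n d D \<Longrightarrow> finite D"
  by (rule finite_subset[of _ "Pow {1..n}"]) (auto simp: uniform_def)

lemma finite_subset_atLeast1: "F \<subseteq> {1..n::nat} \<Longrightarrow> finite F"
  using finite_subset by blast

text \<open>The members of \<open>E\<close> are appended one at a time. Against an earlier
  \<open>G \<in> D\<close> the witness comes from \<open>step\<close>; against an earlier
  \<open>G \<in> E\<close>, by \<open>star\<close>, \<open>G\<close> is its own witness
  \<open>H\<close>.\<close>

lemma has_lq_order_Un: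
  assumes "has_lq_order D" "finite E" "D \<inter> E = {}"
    and step: "\<And>F. F \<in> E \<Longrightarrow> lq_step D F"
    and star: "\<And>F G. F \<in> E \<Longrightarrow> G \<in> E \<Longrightarrow> F \<noteq> G \<Longrightarrow> \<exists>v. G - F = {v}"
  shows "has_lq_order (D \<union> E)"
  using assms(2,3) step star
proof (induction E rule: finite_induct)
  case empty
  then show ?case using assms(1) by simp
next
  case (insert F E)
  have "has_lq_order (D \<union> E)"
    using insert.prems by (intro insert.IH) auto
  then obtain Fs where Fs: "distinct Fs" "set Fs = D \<union> E" "lq_order Fs"
    by (auto simp: has_lq_order_def)
  have "\<exists>H\<in>D \<union> E. \<exists>v\<in>G. H - F = {v}" if "G \<in> D \<union> E" for G
  proof (cases "G \<in> D")
    case True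
    then show ?thesis using insert.prems(2)[of F] unfolding lq_step_def by blast
  next
    case False
    then have "G \<in> E" using that by simp
    moreover have "G \<noteq> F" using \<open>G \<in> E\<close> insert.hyps by blast
    ultimately obtain v where "G - F = {v}" using insert.prems(3)[of F G] by blast
    then show ?thesis using \<open>G \<in> E\<close> by blast
  qed
  then have "lq_step (set Fs) F" by (simp add: lq_step_def Fs)
  moreover have "F \<notin> set Fs" using Fs insert.hyps insert.prems(1) by auto
  ultimately show ?case
    unfolding has_lq_order_def using Fs
    by (intro exI[of _ "Fs @ [F]"]) auto
qed

section \<open>Simplicial subcircuits and linear quotients\<close>

lemma card_Suc_supersetE:
  assumes "e \<subseteq> F" "card F = card e + 1"
  obtains v where "v \<notin> e" "F = insert v e"
proof -
  have fin: "finite F" using assms(2) card.infinite by fastforce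
  then have "card (F - e) = 1"
    using assms card_Diff_subset[of e F] finite_subset by fastforce
  then obtain v where "F - e = {v}" by (auto simp: card_1_singleton_iff)
  then show thesis using that[of v] assms(1) by blast
qed

lemma subset_closed_nbhd:
  assumes "F \<in> C" "e \<subseteq> F" "F \<subseteq> {1..n}" "card F = card e + 1"
  shows "F \<subseteq> closed_nbhd n C e"
proof -
  from assms(2,4) obtain v where "F = insert v e" by (rule card_Suc_supersetE)
  then show ?thesis using assms by (auto simp: closed_nbhd_def)
qed

lemma compl_clutter_nbhd:
  assumes "G \<in> compl_clutter n d C" "clique n d C (closed_nbhd n C e)"
    and "e \<subseteq> {1..n}" "card e = d"
  obtains v where "v \<in> G" "v \<notin> closed_nbhd n C e" "v \<notin> e" "insert v e \<in> compl_clutter n d C"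
proof -
  have "\<not> G \<subseteq> closed_nbhd n C e"
    using assms by (auto simp: compl_clutter_def clique_def)
  then obtain v where v: "v \<in> G" "v \<notin> closed_nbhd n C e"
    by blast
  moreover from v have "v \<notin> e" by (auto simp: closed_nbhd_def)
  moreover have "insert v e \<in> compl_clutter n d C"
    using assms v \<open>v \<notin> e\<close> finite_subset_atLeast1[OF assms(3)]
    by (auto simp: compl_clutter_def closed_nbhd_def)
  ultimately show thesis using that by blast
qed

text \<open>The sets that become non-circuits are the circuits through \<open>e\<close>. They lie
  inside \<open>N[e]\<close>, so \<open>insert v e\<close> with \<open>v\<close> outside
  \<open>N[e]\<close> meets the complement of each of them in \<open>v\<close> alone. Any two of
  them share \<open>e\<close> and differ in one further vertex.\<close>

lemma has_lq_order_delete: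
  assumes C: "clutter n d C" and e: "simplicial_ms n d C e"
    and lq: "has_lq_order (compl_clutter n d C)"
  shows "has_lq_order (compl_clutter n d (delete C e))"
proof -
  define E where "E = {F\<in>C. e \<subseteq> F}"
  have eq: "compl_clutter n d (delete C e) = compl_clutter n d C \<union> E"
    using C by (auto simp: compl_clutter_def delete_def E_def clutter_def)
  have en: "e \<subseteq> {1..n}" "card e = d" and cl: "clique n d C (closed_nbhd n C e)"
    using e by (auto simp: simplicial_ms_def maximal_subcircuit_def)
  have E: "F \<subseteq> {1..n}" "card F = card e + 1" "e \<subseteq> F" "F \<in> C" if "F \<in> E" for F
    using that C en by (auto simp: E_def clutter_def)
  show ?thesis
    unfolding eq
  proof (rule has_lq_order_Un[OF lq])
    have "uniform n (d+1) E" using E en by (auto simp: uniform_def)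
    then show "finite E" by (rule uniform_finite)
    show "compl_clutter n d C \<inter> E = {}" by (auto simp: compl_clutter_def E_def)
  next
    fix F assume F: "F \<in> E"
    show "lq_step (compl_clutter n d C) F"
      unfolding lq_step_def
    proof
      fix G assume "G \<in> compl_clutter n d C"
      then obtain v where v: "v \<in> G" "v \<notin> closed_nbhd n C e" "insert v e \<in> compl_clutter n d C"
        using compl_clutter_nbhd cl en by metis
      have "F \<subseteq> closed_nbhd n C e"
        using E[OF F] by (intro subset_closed_nbhd)
      then have "insert v e - F = {v}" using v E[OF F] by auto
      then show "\<exists>H\<in>compl_clutter n d C. \<exists>v\<in>G. H - F = {v}" using v by blast
    qed
  next
    fix F G assume "F \<in> E" "G \<in> E" "F \<noteq> G"
    then show "\<exists>v. G - F = {v}"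
      using E[of F] E[of G] by (metis card_Suc_supersetE insert_Diff_if Diff_eq_empty_iff insertE)
  qed
qed

text \<open>For \<open>D\<close> inside the subsets of \<open>{1..n}\<close>, these are the supports
  of the squarefree monomials of degree \<open>d + 1\<close> in the ideal generated by the
  \<open>x_F\<close>, \<open>F \<in> D\<close>.\<close>

definition upper_shadow :: "nat \<Rightarrow> nat \<Rightarrow> nat set set \<Rightarrow> nat set set" where
  "upper_shadow n d D = {G. G \<subseteq> {1..n} \<and> card G = d + 1 \<and> (\<exists>F\<in>D. F \<subseteq> G)}"

text \<open>Appending \<open>F\<close> to the order adds new sets \<open>insert w F\<close> to the
  shadow. If \<open>H - F = {v}\<close> for an earlier \<open>H\<close>, then
  \<open>insert v F\<close> contains \<open>H\<close>, so it is an old member of the shadow, and it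
  serves as witness for each new set.\<close>

lemma has_lq_order_upper_shadow:
  assumes "uniform n d (set Fs)" "lq_order Fs"
  shows "has_lq_order (upper_shadow n d (set Fs))"
  using assms
proof (induction Fs rule: rev_induct)
  case Nil
  then show ?case
    by (auto simp: upper_shadow_def has_lq_order_def)
next
  case (snoc F Fs)
  let ?D = "upper_shadow n d (set Fs)"
  define E where "E = upper_shadow n d {F} - ?D"
  have F: "F \<subseteq> {1..n}" "card F = d" "finite F"
    using snoc.prems finite_subset_atLeast1 by (auto simp: uniform_def)
  have un: "uniform n d (set Fs)" and step: "lq_step (set Fs) F" and lq: "lq_order Fs"
    using snoc.prems by (auto simp: uniform_def)
  have eq: "upper_shadow n d (set (Fs @ [F])) = ?D \<union> E"
    by (auto simp: upper_shadow_def E_def)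
  have E: "\<exists>v. v \<notin> F \<and> G = insert v F" if "G \<in> E" for G
    using that F by (auto simp: E_def upper_shadow_def elim!: card_Suc_supersetE[of F G])
  show ?case
    unfolding eq
  proof (rule has_lq_order_Un)
    show "has_lq_order ?D" using snoc.IH un lq by simp
    have "uniform n (d+1) E" by (auto simp: uniform_def E_def upper_shadow_def)
    then show "finite E" by (rule uniform_finite)
    show "?D \<inter> E = {}" by (auto simp: E_def)
  next
    fix K assume K: "K \<in> E"
    then obtain w where w: "w \<notin> F" "K = insert w F" using E by blast
    show "lq_step ?D K"
      unfolding lq_step_def
    proof
      fix G assume "G \<in> ?D"
      then obtain F' where "F' \<in> set Fs" "F' \<subseteq> G" by (auto simp: upper_shadow_def)
      then obtain H v where H: "H \<in> set Fs" "v \<in> F'" "H - F = {v}"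
        using step by (fastforce simp: lq_step_def)
      have "v \<in> H" "v \<notin> F" using H by auto
      have "H \<subseteq> {1..n}" using H un by (simp add: uniform_def)
      with \<open>v \<in> H\<close> have "v \<in> {1..n}" ..
      have "H \<subseteq> insert v F" using H by blast
      then have D: "insert v F \<in> ?D"
        using F H \<open>v \<in> {1..n}\<close> \<open>v \<notin> F\<close> by (auto simp: upper_shadow_def)
      \<comment> \<open>\<open>insert v F\<close> belongs to the old shadow, whereas
        \<open>K = insert w F\<close> is new.\<close>
      have "v \<noteq> w" using D K w by (auto simp: E_def)
      then have "insert v F - K = {v}" using w \<open>v \<notin> F\<close> by blast
      then show "\<exists>H\<in>?D. \<exists>v\<in>G. H - K = {v}" using D H \<open>F' \<subseteq> G\<close> by blast
    qed
  next
    fix K G assume "K \<in> E" "G \<in> E" "K \<noteq> G"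
    then show "\<exists>v. G - K = {v}" using E[of K] E[of G] by auto
  qed
qed

text \<open>A member \<open>G\<close> of \<open>D\<close> cannot lie in \<open>N[e]\<close>:
  enlarged by a further vertex of the clique it would be a circuit, although it contains
  \<open>G\<close>. A vertex \<open>v\<close> of \<open>G\<close> outside \<open>N[e]\<close> makes
  \<open>insert v e\<close> a non-circuit, so it contains some \<open>H \<in> D\<close>, and
  \<open>H - e = {v}\<close>.\<close>

lemma lq_step_simplicial:
  assumes D: "uniform n d D" "e \<subseteq> {1..n}" "card e = d" "e \<notin> D"
    and C: "C = {G. G \<subseteq> {1..n} \<and> card G = d + 1} - upper_shadow n d D"
    and e: "C = {} \<or> simplicial_ms n d C e"
  shows "lq_step D e"
  unfolding lq_step_def
proof
  fix G assume G: "G \<in> D"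
  then have G': "G \<subseteq> {1..n}" "card G = d" "finite G" "finite e"
    using D finite_subset_atLeast1 by (auto simp: uniform_def)
  have "\<not> G \<subseteq> closed_nbhd n C e"
  proof
    assume sub: "G \<subseteq> closed_nbhd n C e"
    have "\<not> G \<subseteq> e" using G G' D card_subset_eq by metis
    then obtain v where v: "v \<in> G" "v \<notin> e" by blast
    \<comment> \<open>This circuit rules out \<open>C = {}\<close>, so \<open>e\<close> is
      simplicial and the clique property becomes available.\<close>
    then have "insert v e \<in> C" using sub by (auto simp: closed_nbhd_def)
    with e have cl: "clique n d C (closed_nbhd n C e)" by (auto simp: simplicial_ms_def)
    \<comment> \<open>A vertex \<open>w\<close> of \<open>N[e]\<close> outside \<open>G\<close> is
      wanted; it exists because \<open>e\<close> is in \<open>N[e]\<close> but not inside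
      \<open>G\<close>, which has the same size.\<close>
    have "card G < card (closed_nbhd n C e)"
    proof (rule psubset_card_mono)
      show "finite (closed_nbhd n C e)" using G' by (simp add: closed_nbhd_def)
      have "\<not> e \<subseteq> G" using G G' D card_subset_eq by metis
      then show "G \<subset> closed_nbhd n C e" using sub by (auto simp: closed_nbhd_def)
    qed
    then obtain w where w: "w \<in> closed_nbhd n C e" "w \<notin> G"
      using G'(3) card_mono leD by (metis subsetI)
    then have "insert w G \<in> C"
      using cl sub G' by (auto simp: clique_def)
    moreover have "insert w G \<in> upper_shadow n d D"
      using G G' w cl by (auto simp: upper_shadow_def clique_def)
    ultimately show False by (simp add: C)
  qed
  then obtain v where v: "v \<in> G" "v \<notin> closed_nbhd n C e" by blast
  then have "v \<notin> e" "v \<in> {1..n}" "insert v e \<notin> C" using G' by (auto simp: closed_nbhd_def)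
  then have "insert v e \<in> upper_shadow n d D"
    using D G' by (auto simp: C)
  then obtain H where H: "H \<in> D" "H \<subseteq> insert v e" by (auto simp: upper_shadow_def)
  have "\<not> H \<subseteq> e" using H D G' card_subset_eq by (metis uniform_def)
  then have "H - e = {v}" using H by blast
  then show "\<exists>H\<in>D. \<exists>v\<in>G. H - e = {v}" using H v by blast
qed

section \<open>Squarefree monomial ideals\<close>

lemma poly_ring_simps [simp]:
  "monoid.mult (poly_ring n) = (*)" "one (poly_ring n) = 1"
  "zero (poly_ring n) = 0" "add (poly_ring n) = (+)"
  by (simp_all add: poly_ring_def)

lemma carrier_poly_ring:
  "carrier (poly_ring n) = {p. \<forall>a\<in>Poly_Mapping.keys p. Poly_Mapping.keys a \<subseteq> {1..n}}"
  by (simp add: poly_ring_def)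

lemma keys_add_nat:
  fixes a b :: "'a \<Rightarrow>\<^sub>0 nat"
  shows "Poly_Mapping.keys (a + b) = Poly_Mapping.keys a \<union> Poly_Mapping.keys b"
  by (auto simp: in_keys_iff lookup_add)

lemma poly_ring_cring: "cring (poly_ring n :: 'k::field mpoly ring)"
proof (rule cringI)
  let ?R = "poly_ring n :: 'k mpoly ring"
  show "abelian_group ?R"
  proof (rule abelian_groupI)
    fix p q :: "'k mpoly" assume "p \<in> carrier ?R" "q \<in> carrier ?R"
    then show "p \<oplus>\<^bsub>?R\<^esub> q \<in> carrier ?R"
      using Poly_Mapping.keys_add[of p q] by (auto simp: carrier_poly_ring)
  next
    fix p :: "'k mpoly" assume "p \<in> carrier ?R"
    then show "\<exists>q\<in>carrier ?R. q \<oplus>\<^bsub>?R\<^esub> p = \<zero>\<^bsub>?R\<^esub>"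
      by (intro bexI[of _ "- p"]) (auto simp: carrier_poly_ring in_keys_iff lookup_uminus)
  qed (auto simp: carrier_poly_ring ac_simps)
  show "comm_monoid ?R"
  proof (rule comm_monoidI)
    fix p q :: "'k mpoly" assume pq: "p \<in> carrier ?R" "q \<in> carrier ?R"
    show "p \<otimes>\<^bsub>?R\<^esub> q \<in> carrier ?R"
      using pq Poly_Mapping.keys_mult[of p q] by (fastforce simp: carrier_poly_ring keys_add_nat)
  qed (auto simp: carrier_poly_ring ac_simps)
qed (simp add: algebra_simps)

section \<open>Terms of a polynomial and multiplication by a monomial\<close>

lemma poly_mapping_eq_sum_single:
  "p = (\<Sum>a\<in>Poly_Mapping.keys p. Poly_Mapping.single a (Poly_Mapping.lookup p a))"
  by (rule poly_mapping_eqI)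
    (auto simp: lookup_sum lookup_single when_def in_keys_iff)

lemma lookup_mult_single:
  fixes p :: "('a::cancel_comm_monoid_add) \<Rightarrow>\<^sub>0 'k::comm_semiring_1"
  shows "Poly_Mapping.lookup (p * Poly_Mapping.single u 1) (a + u) = Poly_Mapping.lookup p a"
proof -
  have "p * Poly_Mapping.single u 1 =
    (\<Sum>a\<in>Poly_Mapping.keys p. Poly_Mapping.single (a + u) (Poly_Mapping.lookup p a))"
    by (subst (1) poly_mapping_eq_sum_single) (simp add: sum_distrib_right mult_single)
  then show ?thesis by (auto simp: lookup_sum lookup_single when_def in_keys_iff)
qed

text \<open>Multiplying by a monomial shifts exponents injectively, so no terms cancel; for a
  general factor only the first inclusion would hold.\<close>

lemma keys_mult_single:
  fixes p :: "('a::cancel_comm_monoid_add) \<Rightarrow>\<^sub>0 'k::comm_semiring_1"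
  shows "Poly_Mapping.keys (p * Poly_Mapping.single u 1) = (\<lambda>a. a + u) ` Poly_Mapping.keys p"
    (is "?L = ?R")
proof
  show "?L \<subseteq> ?R" using Poly_Mapping.keys_mult[of p "Poly_Mapping.single u 1"] by auto
  show "?R \<subseteq> ?L" by (auto simp: in_keys_iff lookup_mult_single)
qed

section \<open>Exponent vectors of squarefree monomials\<close>

definition indicator_exp :: "nat set \<Rightarrow> nat \<Rightarrow>\<^sub>0 nat" where
  "indicator_exp F = (\<Sum>i\<in>F. Poly_Mapping.single i 1)"

lemma lookup_indicator_exp:
  "finite F \<Longrightarrow> Poly_Mapping.lookup (indicator_exp F) i = (if i \<in> F then 1 else 0)"
  by (auto simp: indicator_exp_def lookup_sum lookup_single when_def)

lemma keys_indicator_exp [simp]: "finite F \<Longrightarrow> Poly_Mapping.keys (indicator_exp F) = F"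
  by (auto simp: in_keys_iff lookup_indicator_exp split: if_splits)

lemma var_prod_eq_single:
  "finite F \<Longrightarrow> (var_prod F :: 'k::field mpoly) = Poly_Mapping.single (indicator_exp F) 1"
  unfolding var_prod_def indicator_exp_def
  by (induction F rule: finite_induct) (simp_all add: var_def mult_single)

text \<open>Variables are the squarefree monomials of singletons, so ideals generated by variables
  fall under the description of squarefree monomial ideals below.\<close>

lemma var_image_eq: "var ` V = var_prod ` (\<lambda>v. {v}) ` V"
  by (auto simp: var_prod_def image_iff)

lemma var_prod_inject:
  assumes "finite F" "finite G" "(var_prod F :: 'k::field mpoly) = var_prod G"
  shows "F = G"
proof -
  have "Poly_Mapping.keys (var_prod F :: 'k mpoly) = Poly_Mapping.keys (var_prod G :: 'k mpoly)"
    using assms(3) by simp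
  then have "indicator_exp F = indicator_exp G"
    using assms(1,2) by (simp add: var_prod_eq_single)
  then show ?thesis using assms keys_indicator_exp by metis
qed

lemma inj_on_var_prod:
  assumes "uniform n d D"
  shows "inj_on (var_prod :: _ \<Rightarrow> 'k::field mpoly) D"
proof (rule inj_onI)
  fix F G assume "F \<in> D" "G \<in> D" and eq: "(var_prod F :: 'k mpoly) = var_prod G"
  then have "F \<subseteq> {1..n}" "G \<subseteq> {1..n}" using assms by (auto simp: uniform_def)
  then show "F = G" by (rule var_prod_inject[OF finite_subset_atLeast1 finite_subset_atLeast1 eq])
qed

lemma indicator_exp_dvd:
  assumes "finite F" "F \<subseteq> Poly_Mapping.keys a"
  obtains c where "a = c + indicator_exp F"
proof
  \<comment> \<open>Subtraction truncates at 0, but is exact here since \<open>a\<close> has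
    exponent at least 1 on \<open>F\<close>.\<close>
  show "a = (a - indicator_exp F) + indicator_exp F"
    using assms by (intro poly_mapping_eqI)
      (auto simp: lookup_add lookup_minus lookup_indicator_exp in_keys_iff)
qed

text \<open>A monomial is divisible by \<open>x_F\<close> iff its support contains \<open>F\<close>.
  Supports only grow under multiplication, so the right side is an ideal containing the generators;
  conversely each term of such a \<open>p\<close> is a multiple of a generator.\<close>

lemma Idl_var_prod:
  assumes D: "\<And>F. F \<in> D \<Longrightarrow> F \<subseteq> {1..n}"
  shows "Idl\<^bsub>poly_ring n\<^esub> (var_prod ` D) =
    {p \<in> carrier (poly_ring n :: 'k::field mpoly ring).
       \<forall>a\<in>Poly_Mapping.keys p. \<exists>F\<in>D. F \<subseteq> Poly_Mapping.keys a}" (is "Idl\<^bsub>?R\<^esub> ?G = ?M")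
proof -
  interpret cring ?R by (rule poly_ring_cring)
  have fin: "finite F" if "F \<in> D" for F using D[OF that] finite_subset by blast
  have G: "?G \<subseteq> ?M"
  proof
    fix x :: "'k mpoly" assume "x \<in> ?G"
    then show "x \<in> ?M" using D fin by (fastforce simp: var_prod_eq_single carrier_poly_ring)
  qed
  have mult: "y * x \<in> ?M" if "x \<in> ?M" "y \<in> carrier ?R" for x y
  proof -
    have "y * x \<in> carrier ?R" using that m_closed[of y x] by simp
    moreover have "\<exists>F\<in>D. F \<subseteq> Poly_Mapping.keys a" if a: "a \<in> Poly_Mapping.keys (y * x)" for a
    proof -
      obtain b c where "a = b + c" "c \<in> Poly_Mapping.keys x"
        using a Poly_Mapping.keys_mult[of y x] by blast
      moreover from this obtain F where "F \<in> D" "F \<subseteq> Poly_Mapping.keys c"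
        using \<open>x \<in> ?M\<close> by blast
      ultimately show ?thesis by (auto simp: keys_add_nat)
    qed
    ultimately show ?thesis by blast
  qed
  have ideal: "ideal ?M ?R"
  proof (rule idealI)
    show "subgroup ?M (add_monoid ?R)"
    proof (rule add.subgroupI)
      show "?M \<noteq> {}" by (auto intro!: exI[of _ 0] simp: carrier_poly_ring)
    next
      fix p assume p: "p \<in> ?M"
      \<comment> \<open>Negation is multiplication by the constant -1, so it is covered by
        \<open>mult\<close>.\<close>
      then have "(- 1) * p \<in> ?M"
        using a_inv_closed[OF one_closed]
        by (intro mult) (auto simp: carrier_poly_ring in_keys_iff lookup_uminus lookup_one when_def)
      moreover have "\<ominus>\<^bsub>?R\<^esub> p = - p"
        using p calculation by (intro minus_equality) auto
      ultimately show "\<ominus>\<^bsub>?R\<^esub> p \<in> ?M" by simp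
    next
      fix p q assume pq: "p \<in> ?M" "q \<in> ?M"
      then have "p + q \<in> carrier ?R" using a_closed[of p q] by simp
      moreover have "\<exists>F\<in>D. F \<subseteq> Poly_Mapping.keys a" if "a \<in> Poly_Mapping.keys (p + q)" for a
        using that pq Poly_Mapping.keys_add[of p q] by blast
      ultimately show "p \<oplus>\<^bsub>?R\<^esub> q \<in> ?M" by simp
    qed auto
  qed (use mult in \<open>auto simp: ring_axioms mult.commute\<close>)
  show ?thesis
  proof
    show "Idl\<^bsub>?R\<^esub> ?G \<subseteq> ?M" by (rule genideal_minimal[OF ideal G])
  next
    have "?G \<subseteq> carrier ?R" using G by blast
    then interpret I: ideal "Idl\<^bsub>?R\<^esub> ?G" ?R by (rule genideal_ideal)
    \<comment> \<open>For infinite \<open>A\<close> the sum is 0 by convention, which also lies in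
      the ideal.\<close>
    have sum: "sum f A \<in> Idl\<^bsub>?R\<^esub> ?G" if "\<And>a. a \<in> A \<Longrightarrow> f a \<in> Idl\<^bsub>?R\<^esub> ?G"
      for f :: "(nat \<Rightarrow>\<^sub>0 nat) \<Rightarrow> 'k mpoly" and A
      using that I.zero_closed I.a_closed by (induction A rule: infinite_finite_induct) auto
    show "?M \<subseteq> Idl\<^bsub>?R\<^esub> ?G"
    proof
      fix p assume p: "p \<in> ?M"
      have "Poly_Mapping.single a (Poly_Mapping.lookup p a) \<in> Idl\<^bsub>?R\<^esub> ?G"
        if a: "a \<in> Poly_Mapping.keys p" for a
      proof -
        obtain F where F: "F \<in> D" "F \<subseteq> Poly_Mapping.keys a" using p a by blast
        then obtain c where c: "a = c + indicator_exp F" using fin indicator_exp_dvd by metis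
        let ?q = "Poly_Mapping.single c (Poly_Mapping.lookup p a)"
        have "Poly_Mapping.keys a \<subseteq> {1..n}" using p a by (auto simp: carrier_poly_ring)
        then have "?q \<in> carrier ?R" by (auto simp: carrier_poly_ring c keys_add_nat)
        moreover have "var_prod F \<in> Idl\<^bsub>?R\<^esub> ?G"
          using F(1) genideal_self[OF \<open>?G \<subseteq> carrier ?R\<close>] by blast
        ultimately have "?q * var_prod F \<in> Idl\<^bsub>?R\<^esub> ?G"
          using I.I_l_closed by fastforce
        then show ?thesis using F fin by (simp add: var_prod_eq_single mult_single flip: c)
      qed
      then show "p \<in> Idl\<^bsub>?R\<^esub> ?G"
        using sum[of "Poly_Mapping.keys p"] poly_mapping_eq_sum_single[of p] by metis
    qed
  qed
qed

lemma var_prod_in_Idl_iff: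
  assumes "\<And>F. F \<in> D \<Longrightarrow> F \<subseteq> {1..n}" "G \<subseteq> {1..n}"
  shows "(var_prod G :: 'k::field mpoly) \<in> Idl\<^bsub>poly_ring n\<^esub> (var_prod ` D) \<longleftrightarrow> (\<exists>F\<in>D. F \<subseteq> G)"
  using finite_subset_atLeast1[OF assms(2)] assms(2)
  by (simp add: Idl_var_prod[OF assms(1)] var_prod_eq_single carrier_poly_ring)

text \<open>All generators have the same degree, so none properly divides another, and every
  monomial of the ideal is divisible by one of them.\<close>

lemma min_mono_gens_Idl:
  assumes D: "uniform n d D"
  shows "min_mono_gens n (Idl\<^bsub>poly_ring n\<^esub> (var_prod ` D)) = (var_prod ` D :: 'k::field mpoly set)"
proof -
  let ?I = "Idl\<^bsub>poly_ring n\<^esub> (var_prod ` D) :: 'k mpoly set"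
  have Dn: "F \<subseteq> {1..n}" if "F \<in> D" for F using that D by (auto simp: uniform_def)
  have fin: "finite F" if "F \<in> D" for F using finite_subset_atLeast1[OF Dn[OF that]] .
  have mono: "var_prod F \<in> monomials n \<inter> ?I" if "F \<in> D" for F
  proof
    show "var_prod F \<in> ?I" using that Dn by (subst var_prod_in_Idl_iff) auto
    show "var_prod F \<in> monomials n"
      unfolding monomials_def using Dn[OF that] fin[OF that]
      by (auto simp: var_prod_eq_single intro!: exI[of _ "indicator_exp F"])
  qed
  have key: "v = var_prod F" if F: "F \<in> D" and v: "v \<in> monomials n \<inter> ?I" "v divides\<^bsub>poly_ring n\<^esub> var_prod F"
    for F v
  proof -
    obtain b where b: "v = Poly_Mapping.single b 1" using v by (auto simp: monomials_def)
    obtain c where c: "var_prod F = v * c" using v by (auto simp: factor_def)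
    \<comment> \<open>The cofactor \<open>c\<close> is an arbitrary polynomial; comparing keys
      yields an exponent of \<open>c\<close> that completes \<open>b\<close> to the exponent of
      \<open>x_F\<close>.\<close>
    then have "Poly_Mapping.keys (var_prod F :: 'k mpoly) = (\<lambda>a. a + b) ` Poly_Mapping.keys c"
      by (simp add: b keys_mult_single mult.commute)
    then obtain a where a: "indicator_exp F = a + b"
      using fin[OF F] by (auto simp: var_prod_eq_single)
    then have "F = Poly_Mapping.keys a \<union> Poly_Mapping.keys b"
      using fin[OF F] keys_add_nat keys_indicator_exp by metis
    moreover obtain G where G: "G \<in> D" "G \<subseteq> Poly_Mapping.keys b"
      using v by (auto simp: Idl_var_prod[OF Dn] b)
    ultimately have "G \<subseteq> F" by blast
    then have "G = F" using G F D fin[OF F] by (intro card_subset_eq) (auto simp: uniform_def)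
    with G obtain a' where "b = a' + indicator_exp F" using fin indicator_exp_dvd by metis
    \<comment> \<open>Now \<open>x_F\<close> and \<open>v\<close> divide each other; over the
      naturals \<open>a + a' = 0\<close> makes both cofactor exponents vanish.\<close>
    with a have "a + a' = 0" by (metis add.assoc add_cancel_left_left)
    then have "a = 0"
      by (metis keys_add_nat keys_zero sup_eq_bot_iff keys_eq_empty)
    with a show ?thesis using fin[OF F] by (simp add: var_prod_eq_single b)
  qed
  show ?thesis
  proof (intro equalityI subsetI)
    fix u assume u: "u \<in> min_mono_gens n ?I"
    then obtain a where a: "u = Poly_Mapping.single a 1" "Poly_Mapping.keys a \<subseteq> {1..n}"
      by (auto simp: min_mono_gens_def monomials_def)
    have "u \<in> ?I" using u by (auto simp: min_mono_gens_def)
    then obtain F where F: "F \<in> D" "F \<subseteq> Poly_Mapping.keys a"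
      by (auto simp: Idl_var_prod[OF Dn] a)
    then obtain c where c: "a = c + indicator_exp F" using fin indicator_exp_dvd by metis
    have "u = var_prod F * Poly_Mapping.single c 1"
      using F fin by (simp add: a c var_prod_eq_single mult_single add.commute)
    moreover have "(Poly_Mapping.single c 1 :: 'k mpoly) \<in> carrier (poly_ring n)"
      using a(2) by (auto simp: c keys_add_nat carrier_poly_ring)
    ultimately have "var_prod F divides\<^bsub>poly_ring n\<^esub> u" by (auto simp: factor_def)
    then have "var_prod F = u" using u mono[OF F(1)] by (auto simp: min_mono_gens_def)
    then show "u \<in> var_prod ` D" using F by auto
  next
    fix u assume "u \<in> (var_prod ` D :: 'k mpoly set)"
    then show "u \<in> min_mono_gens n ?I" using mono key by (auto simp: min_mono_gens_def)
  qed
qed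

text \<open>Membership in the colon ideal is tested on the support of each term, which must contain
  some \<open>G - F\<close>. Testing the monomials \<open>x_(G - F)\<close> and the single variables
  turns equality with an ideal of variables into \<open>lq_step\<close>.\<close>

lemma colon_linear_iff_lq_step:
  assumes D: "uniform n d D" and F: "F \<subseteq> {1..n}" "card F = d" "F \<notin> D"
  shows "(\<exists>V\<subseteq>{1..n}. colon_ideal (poly_ring n) (Idl\<^bsub>poly_ring n\<^esub> (var_prod ` D)) (var_prod F) =
           (Idl\<^bsub>poly_ring n\<^esub> (var ` V) :: 'k::field mpoly set)) \<longleftrightarrow> lq_step D F"
proof -
  let ?R = "poly_ring n :: 'k mpoly ring"
  let ?colon = "colon_ideal ?R (Idl\<^bsub>?R\<^esub> (var_prod ` D)) (var_prod F)"
  interpret cring ?R by (rule poly_ring_cring)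
  have Dn: "G \<subseteq> {1..n}" if "G \<in> D" for G using that D by (auto simp: uniform_def)
  have finF: "finite F" using finite_subset_atLeast1[OF F(1)] .
  have Fc: "var_prod F \<in> carrier ?R" using finF F by (simp add: var_prod_eq_single carrier_poly_ring)
  have colon: "?colon = {p \<in> carrier ?R. \<forall>a\<in>Poly_Mapping.keys p. \<exists>G\<in>D. G - F \<subseteq> Poly_Mapping.keys a}"
  proof -
    have "p * var_prod F \<in> carrier ?R" if "p \<in> carrier ?R" for p
      using m_closed[OF that Fc] by simp
    then show ?thesis
      using finF by (auto simp: colon_ideal_def Idl_var_prod[OF Dn] var_prod_eq_single
          keys_mult_single keys_add_nat Diff_subset_conv Un_commute)
  qed
  have vars: "Idl\<^bsub>?R\<^esub> (var ` V) =
      {p \<in> carrier ?R. \<forall>a\<in>Poly_Mapping.keys p. V \<inter> Poly_Mapping.keys a \<noteq> {}}"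
    if "V \<subseteq> {1..n}" for V
    unfolding var_image_eq using that by (subst Idl_var_prod) auto
  have mem: "var_prod G \<in> carrier ?R" "Poly_Mapping.keys (var_prod G :: 'k mpoly) = {indicator_exp G}"
    "Poly_Mapping.keys (indicator_exp G) = G" if "G \<subseteq> {1..n}" for G
    using finite_subset_atLeast1[OF that] that by (auto simp: var_prod_eq_single carrier_poly_ring)
  show ?thesis
  proof
    assume "\<exists>V\<subseteq>{1..n}. ?colon = Idl\<^bsub>?R\<^esub> (var ` V)"
    then obtain V where V: "V \<subseteq> {1..n}" and eq: "?colon = Idl\<^bsub>?R\<^esub> (var ` V)" by blast
    show "lq_step D F"
      unfolding lq_step_def
    proof
      fix G assume G: "G \<in> D"
      have "G - F \<subseteq> {1..n}" using Dn[OF G] by blast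
      note m = mem[OF this]
      have "var_prod (G - F) \<in> ?colon" unfolding colon using m G by auto
      then obtain v where v: "v \<in> V" "v \<in> G - F"
        unfolding eq vars[OF V] using m by auto
      have "{v} \<subseteq> {1..n}" using v V by blast
      note m = mem[OF this]
      have "var_prod {v} \<in> ?colon" unfolding eq vars[OF V] using m v by auto
      then obtain H where H: "H \<in> D" "H - F \<subseteq> {v}" unfolding colon using m by auto
      \<comment> \<open>\<open>H\<close> and \<open>F\<close> have the same size and
        \<open>F\<close> is not in \<open>D\<close>.\<close>
      have "\<not> H \<subseteq> F" using H(1) D F finF card_subset_eq by (metis uniform_def)
      then have "H - F = {v}" using H(2) by blast
      then show "\<exists>H\<in>D. \<exists>v\<in>G. H - F = {v}" using H v by blast
    qed
  next
    assume step: "lq_step D F"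
    \<comment> \<open>These are the indices of all variables lying in the colon ideal.\<close>
    define V where "V = {v. \<exists>H\<in>D. H - F = {v}}"
    have V: "V \<subseteq> {1..n}" using Dn by (auto simp: V_def)
    have "(\<exists>G\<in>D. G - F \<subseteq> A) \<longleftrightarrow> V \<inter> A \<noteq> {}" for A
    proof
      assume "\<exists>G\<in>D. G - F \<subseteq> A"
      then obtain G where G: "G \<in> D" "G - F \<subseteq> A" by blast
      then obtain H v where "H \<in> D" "v \<in> G" "H - F = {v}" using step by (auto simp: lq_step_def)
      then show "V \<inter> A \<noteq> {}" using G by (auto simp: V_def)
    next
      assume "V \<inter> A \<noteq> {}"
      then obtain H v where "H \<in> D" "H - F = {v}" "v \<in> A" by (auto simp: V_def)
      then show "\<exists>G\<in>D. G - F \<subseteq> A" by (intro bexI[of _ H]) simp_all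
    qed
    then have "?colon = Idl\<^bsub>?R\<^esub> (var ` V)" unfolding colon vars[OF V] by simp
    then show "\<exists>V\<subseteq>{1..n}. ?colon = Idl\<^bsub>?R\<^esub> (var ` V)" using V by blast
  qed
qed

lemma linear_quotients_order_map:
  assumes D: "uniform n d (set Fs)"
  shows "linear_quotients_order n (Idl\<^bsub>poly_ring n\<^esub> (var_prod ` set Fs) :: 'k::field mpoly set)
           (map var_prod Fs) \<longleftrightarrow> distinct Fs \<and> lq_order Fs"
proof -
  note inj = inj_on_var_prod[OF D, where 'k='k]
  have "(\<exists>V\<subseteq>{1..n}. colon_ideal (poly_ring n)
            (Idl\<^bsub>poly_ring n\<^esub> (set (take i (map var_prod Fs)))) (map var_prod Fs ! i) =
           (Idl\<^bsub>poly_ring n\<^esub> (var ` V) :: 'k mpoly set)) \<longleftrightarrow> lq_step (set (take i Fs)) (Fs ! i)"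
    if "distinct Fs" "i < length Fs" for i
  proof -
    have "uniform n d (set (take i Fs))"
      using D set_take_subset[of i Fs] by (auto simp: uniform_def)
    moreover have "Fs ! i \<subseteq> {1..n}" "card (Fs ! i) = d" using that D by (auto simp: uniform_def)
    moreover have "Fs ! i \<notin> set (take i Fs)"
      using that by (auto simp: in_set_conv_nth nth_eq_iff_index_eq)
    ultimately show ?thesis
      using that colon_linear_iff_lq_step[where 'k='k] by (simp add: take_map)
  qed
  \<comment> \<open>The ranges of \<open>i\<close> differ only at 0, where \<open>lq_step\<close> of
    the empty family holds vacuously.\<close>
  moreover have "lq_order Fs \<longleftrightarrow> (\<forall>i. 1 \<le> i \<and> i < length Fs \<longrightarrow> lq_step (set (take i Fs)) (Fs ! i))"
    unfolding lq_order_def by (metis One_nat_def Suc_leI empty_iff gr0I list.set(1) lq_step_def take_0)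
  moreover have "distinct (map (var_prod :: _ \<Rightarrow> 'k mpoly) Fs) \<longleftrightarrow> distinct Fs"
    using inj by (simp add: distinct_map)
  ultimately show ?thesis
    unfolding linear_quotients_order_def min_mono_gens_Idl[OF D] length_map set_map by blast
qed

text \<open>The entries of the order are the minimal generators \<open>x_F\<close>,
  \<open>F \<in> D\<close>, so supports can be chosen entrywise; injectivity of
  \<open>var_prod\<close> on \<open>D\<close> shows that all of \<open>D\<close> is reached.\<close>

lemma linear_quotients_orderE:
  assumes D: "uniform n d D"
    and us: "linear_quotients_order n (Idl\<^bsub>poly_ring n\<^esub> (var_prod ` D) :: 'k::field mpoly set) us"
  obtains Fs where "us = map var_prod Fs" "distinct Fs" "set Fs = D" "lq_order Fs"
proof -
  have set: "set us = var_prod ` D"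
    using us min_mono_gens_Idl[OF D, where 'k='k] by (simp add: linear_quotients_order_def)
  then have "us \<in> map var_prod ` lists D"
    unfolding lists_image[symmetric] by (simp add: in_lists_conv_set)
  then obtain Fs where Fs: "set Fs \<subseteq> D" "us = map var_prod Fs" by (auto simp: in_lists_conv_set)
  then have "(var_prod :: _ \<Rightarrow> 'k mpoly) ` set Fs = var_prod ` D"
    using set by simp
  then have "set Fs = D"
    using inj_on_image_eq_iff[OF inj_on_var_prod[OF D, where 'k='k]] Fs(1) by blast
  then show thesis
    using that Fs us linear_quotients_order_map[where 'k='k] D by blast
qed

lemma has_linear_quotients_iff:
  assumes "uniform n d D"
  shows "has_linear_quotients n (Idl\<^bsub>poly_ring n\<^esub> (var_prod ` D) :: 'k::field mpoly set)
    \<longleftrightarrow> has_lq_order D"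
  unfolding has_linear_quotients_def has_lq_order_def
  using assms linear_quotients_orderE linear_quotients_order_map by metis

section \<open>The three propositions\<close>

lemma has_linear_quotients_compl_iff:
  "has_linear_quotients n (circuit_ideal n (compl_clutter n d C) :: 'k::field mpoly set)
    \<longleftrightarrow> has_lq_order (compl_clutter n d C)"
  unfolding circuit_ideal_def
  by (rule has_linear_quotients_iff[of _ "d + 1"]) (auto simp: uniform_def compl_clutter_def)

text \<open>This yields that (A) implies (B): a deletion sequence that empties a non-empty clutter
  has a first member, and that member is simplicial in \<open>C\<close> itself.\<close>

lemma chordal_imp_simplicial:
  assumes "chordal n d C" "C \<noteq> {}"
  shows "\<exists>e. simplicial_ms n d C e"
proof -
  from assms obtain es where es: "foldl delete C es = {}"
      "\<forall>i<length es. simplicial_ms n d (foldl delete C (take i es)) (es ! i)"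
    by (auto simp: chordal_def)
  then have "es \<noteq> []" using assms by auto
  then have "simplicial_ms n d C (es ! 0)" using es(2)[rule_format, of 0] by simp
  then show ?thesis ..
qed

lemma chordal_delete:
  assumes "simplicial_ms n d C e" "chordal n d (delete C e)"
  shows "chordal n d C"
proof -
  have "\<exists>es. (\<forall>i<length es. simplicial_ms n d (foldl delete (delete C e) (take i es)) (es ! i)) \<and>
      foldl delete (delete C e) es = {}"
    \<comment> \<open>If the deletion is already empty, the empty sequence serves.\<close>
    using assms(2) unfolding chordal_def by (elim disjE) (auto intro!: exI[of _ "[]"])
  then obtain es where
    es: "\<forall>i<length es. simplicial_ms n d (foldl delete (delete C e) (take i es)) (es ! i)"
      "foldl delete (delete C e) es = {}" by blast
  have "simplicial_ms n d (foldl delete C (take i (e # es))) ((e # es) ! i)"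
    if "i < length (e # es)" for i
    using that es(1) assms(1) by (cases i) auto
  then show ?thesis
    unfolding chordal_def using es(2) by (intro disjI2 exI[of _ "e # es"]) simp
qed

text \<open>Induction on the number of circuits: a maximal subcircuit lies in some circuit, so
  deleting it makes the clutter smaller while linear quotients persist.\<close>

lemma simplicial_imp_chordal:
  assumes B: "lq_imp_simplicial_ms TYPE('k::field) n d"
    and "clutter n d C" "has_lq_order (compl_clutter n d C)"
  shows "chordal n d C"
  using assms(2,3)
proof (induction "card C" arbitrary: C rule: less_induct)
  case less
  show ?case
  proof (cases "C = {}")
    case True
    then show ?thesis by (simp add: chordal_def)
  next
    case False
    then obtain e where e: "simplicial_ms n d C e"
      using B less.prems unfolding lq_imp_simplicial_ms_def has_linear_quotients_compl_iff by blast
    have "uniform n (d + 1) C" using less.prems by (simp add: uniform_def clutter_def)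
    then have "finite C" by (rule uniform_finite)
    moreover have "delete C e \<subset> C"
      using e by (auto simp: simplicial_ms_def maximal_subcircuit_def delete_def)
    ultimately have "card (delete C e) < card C" by (rule psubset_card_mono)
    moreover have "clutter n d (delete C e)" using less.prems by (auto simp: clutter_def delete_def)
    ultimately have "chordal n d (delete C e)"
      using has_lq_order_delete[OF less.prems(1) e less.prems(2)] by (intro less.hyps)
    then show ?thesis by (rule chordal_delete[OF e])
  qed
qed

text \<open>Induction on the number of missing \<open>d\<close>-sets, with one set appended per
  round. (B) concerns circuits of size \<open>d + 1\<close>, which is why it is applied to the
  complement of the shadow.\<close>

lemma lq_order_extend:
  assumes B: "lq_imp_simplicial_ms TYPE('k::field) n d"
    and "uniform n d (set Fs)" "distinct Fs" "lq_order Fs"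
  shows "\<exists>Es. distinct (Fs @ Es) \<and> set (Fs @ Es) = {F. F \<subseteq> {1..n} \<and> card F = d} \<and> lq_order (Fs @ Es)"
  using assms(2-4)
proof (induction "card ({F. F \<subseteq> {1..n} \<and> card F = d} - set Fs)" arbitrary: Fs rule: less_induct)
  case less
  let ?A = "{F. F \<subseteq> {1..n} \<and> card F = d}"
  have finA: "finite ?A" by (rule uniform_finite[of n d]) (auto simp: uniform_def)
  have sub: "set Fs \<subseteq> ?A" using less.prems by (auto simp: uniform_def)
  show ?case
  proof (cases "set Fs = ?A")
    case True
    then show ?thesis using less.prems by (intro exI[of _ "[]"]) auto
  next
    case False
    define C where "C = {G. G \<subseteq> {1..n} \<and> card G = d + 1} - upper_shadow n d (set Fs)"
    have compl: "compl_clutter n d C = upper_shadow n d (set Fs)"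
      by (auto simp: compl_clutter_def C_def upper_shadow_def)
    have cl: "clutter n d C" by (auto simp: clutter_def C_def)
    have "\<exists>e. e \<subseteq> {1..n} \<and> card e = d \<and> e \<notin> set Fs \<and> (C = {} \<or> simplicial_ms n d C e)"
    proof (cases "C = {}")
      case True
      then show ?thesis using False sub by blast
    next
      case nonempty: False
      have "has_lq_order (compl_clutter n d C)"
        unfolding compl using less.prems by (intro has_lq_order_upper_shadow)
      then obtain e where e: "simplicial_ms n d C e"
        using B cl nonempty
        unfolding lq_imp_simplicial_ms_def has_linear_quotients_compl_iff by blast
      \<comment> \<open>\<open>e\<close> lies in a circuit of \<open>C\<close>, and no such circuit
        contains a member of \<open>set Fs\<close>.\<close>
      then have "e \<subseteq> {1..n}" "card e = d" "e \<notin> set Fs"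
        by (auto simp: simplicial_ms_def maximal_subcircuit_def C_def upper_shadow_def)
      then show ?thesis using e by blast
    qed
    then obtain e where e: "e \<subseteq> {1..n}" "card e = d" "e \<notin> set Fs" "C = {} \<or> simplicial_ms n d C e"
      by blast
    have "lq_step (set Fs) e"
      using lq_step_simplicial[OF less.prems(1) e(1-3) C_def e(4)] .
    then have "lq_order (Fs @ [e])" using less.prems by simp
    moreover have "card (?A - set (Fs @ [e])) < card (?A - set Fs)"
      using finA e by (intro psubset_card_mono) auto
    moreover have "uniform n d (set (Fs @ [e]))" "distinct (Fs @ [e])"
      using less.prems e by (auto simp: uniform_def)
    ultimately have "\<exists>Es. distinct ((Fs @ [e]) @ Es) \<and> set ((Fs @ [e]) @ Es) = ?A \<and>
        lq_order ((Fs @ [e]) @ Es)"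
      by (intro less.hyps)
    then obtain Es where "distinct ((Fs @ [e]) @ Es) \<and> set ((Fs @ [e]) @ Es) = ?A \<and>
        lq_order ((Fs @ [e]) @ Es)" ..
    then show ?thesis by (intro exI[of _ "e # Es"]) simp
  qed
qed

text \<open>The given order is translated to supports, extended there and mapped back;
  \<open>map\<close> respects appending, so \<open>us\<close> remains a prefix.\<close>

lemma simplicial_imp_orders_extend:
  assumes B: "lq_imp_simplicial_ms TYPE('k::field) n d"
  shows "lq_orders_extend TYPE('k) n d"
  unfolding lq_orders_extend_def
proof (intro allI impI, elim conjE)
  fix I :: "'k mpoly set" and us
  let ?A = "{F. F \<subseteq> {1..n} \<and> card F = d}"
  have A: "sqfree_monomials n d = (var_prod ` ?A :: 'k mpoly set)"
    by (auto simp: sqfree_monomials_def)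
  assume "sqfree_ideal_gen_in_degree n d I" and us: "linear_quotients_order n I us"
  then obtain U :: "'k mpoly set" where U: "U \<subseteq> var_prod ` ?A" "I = Idl\<^bsub>poly_ring n\<^esub> U"
    unfolding sqfree_ideal_gen_in_degree_def A by blast
  from U(1) obtain D where D: "D \<subseteq> ?A" and "U = var_prod ` D"
    by (rule subset_imageE)
  with U have I: "I = Idl\<^bsub>poly_ring n\<^esub> (var_prod ` D)" by simp
  have "uniform n d D" using D by (auto simp: uniform_def)
  then obtain Fs where Fs: "us = map var_prod Fs" "distinct Fs" "set Fs = D" "lq_order Fs"
    using us unfolding I by (rule linear_quotients_orderE)
  then obtain Es where Es: "distinct (Fs @ Es)" "set (Fs @ Es) = ?A" "lq_order (Fs @ Es)"
    using lq_order_extend[OF B, of Fs] \<open>uniform n d D\<close> by auto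
  have "uniform n d (set (Fs @ Es))" unfolding Es by (simp add: uniform_def)
  then have "linear_quotients_order n (complete_ideal n d :: 'k mpoly set) (map var_prod (Fs @ Es))"
    using linear_quotients_order_map[of n d "Fs @ Es", where 'k='k] Es
    by (simp add: complete_ideal_def A del: set_append)
  then show "\<exists>vs. linear_quotients_order n (complete_ideal n d) (us @ vs)"
    using Fs(1) by auto
qed

theorem theorem2p1:
  fixes n d :: nat
  assumes "d > 0"
  shows "(lq_imp_chordal TYPE('k::field) n d \<longleftrightarrow> lq_imp_simplicial_ms TYPE('k) n d) \<and>
         (lq_imp_simplicial_ms TYPE('k) n d \<longrightarrow> lq_orders_extend TYPE('k) n d)"
proof (intro conjI impI iffI)
  assume "lq_imp_chordal TYPE('k) n d"
  then show "lq_imp_simplicial_ms TYPE('k) n d"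
    unfolding lq_imp_chordal_def lq_imp_simplicial_ms_def using chordal_imp_simplicial by blast
next
  assume B: "lq_imp_simplicial_ms TYPE('k) n d"
  then show "lq_imp_chordal TYPE('k) n d"
    unfolding lq_imp_chordal_def has_linear_quotients_compl_iff using simplicial_imp_chordal by blast
  from B show "lq_orders_extend TYPE('k) n d"
    by (rule simplicial_imp_orders_extend)
qed

end
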